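(* Let $\|\cdot\|_D$ be an idempotent $D$-norm on $\mathbb{R}^d$ with non-empty complete dependence frame $A_1,\dots,A_K$. Then $$\|\bm{x}\|_D=\sum_{k=1}^K\max_{i\in A_k}|x_i| + \sum_{i\in\{1,\dots,d\}\setminus \bigcup_{k=1}^K A_k} |x_i|,\qquad \bm{x}\in\mathbb{R}^d.$$ Conversely, for every collection of nonempty pairwise disjoint subsets $A_1,\dots,A_K$ of $\{1,\dots,d\}$ with $|A_k|\ge 2$ for $1\le k\le K$ and $1\le K<d$, the equation $$\|\bm{x}\|_D:=\sum_{k=1}^K\max_{i\in A_k}|x_i| + \sum_{i\in\{1,\dots,d\}\setminus \bigcup_{k=1}^K A_k} |x_i|,\qquad \bm{x}\in\mathbb{R}^d,$$ defines an idempotent $D$-norm on $\mathbb{R}^d$ with complete dependence frame $A_1,\dots,A_K$.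
   Context: A generator is a random vector $\bm{Z}=(Z_1,\dots,Z_d)$ with $Z_i\ge 0$ almost surely and $E(Z_i)=1$ for $1\le i\le d$. The $D$-norm on $\mathbb{R}^d$ generated by $\bm{Z}$ is $\|\bm{x}\|_D:=E\left(\max_{1\le i\le d}(|x_i|Z_i)\right)$, $\bm{x}\in\mathbb{R}^d$. A $D$-norm is a norm on $\mathbb{R}^d$ that arises in this way from some generator; the generator of a $D$-norm is not unique. For two $D$-norms $\|\cdot\|_{D^{(1)}}$, $\|\cdot\|_{D^{(2)}}$ on $\mathbb{R}^d$, their product $\|\cdot\|_{D^{(1)}D^{(2)}}$ is the $D$-norm generated by the componentwise product $\bm{Z}^{(1)}\bm{Z}^{(2)}$, where $\bm{Z}^{(1)}$, $\bm{Z}^{(2)}$ are independent generators of $\|\cdot\|_{D^{(1)}}$, $\|\cdot\|_{D^{(2)}}$; it does not depend on the choice of these independent generators. A $D$-norm is called idempotent if $\|\cdot\|_{D^2}:=\|\cdot\|_{DD}=\|\cdot\|_D$. Let $\bm{e}_i$ be the $i$-th unit vector of $\mathbb{R}^d$. For $1\le i<j\le d$ the bivariate projection of $\|\cdot\|_D$ is the $D$-norm $\|(x,y)\|_{D_{i,j}}:=\|x\bm{e}_i+y\bm{e}_j\|_D$ on $\mathbb{R}^2$. Complete dependence frame (CDF): if at least one bivariate projection of $\|\cdot\|_D$ equals the sup-norm on $\mathbb{R}^2$, then there exist nonempty pairwise disjoint subsets $A_1,\dots,A_K$ of $\{1,\dots,d\}$, $1\le K<d$, with $|A_k|\ge 2$,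 such that $\left\|\sum_{i\in A_k}x_i\bm{e}_i\right\|_D=\max_{i\in A_k}|x_i|$ for all $\bm{x}\in\mathbb{R}^d$ and $1\le k\le K$, and such that for no subset $B\subset\{1,\dots,d\}$ with $|B|\ge 2$ that is not contained in one of the sets $A_k$ does $\left\|\sum_{i\in B}x_i\bm{e}_i\right\|_D=\max_{i\in B}|x_i|$ hold for all $\bm{x}\in\mathbb{R}^d$. These sets $A_1,\dots,A_K$ (unique up to order) are called the complete dependence frame of $\|\cdot\|_D$. If no bivariate projection of $\|\cdot\|_D$ equals the sup-norm, the complete dependence frame is called empty. *)

theory Defs
  imports "HOL-Probability.Probability"
begin

text \<open>The index set \<open>{1, ..., d}\<close> is the finite type \<open>'n\<close>, with \<open>d = CARD('n)\<close>.\<close>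

definition D_generator :: "'a measure \<Rightarrow> ('a \<Rightarrow> real ^ 'n) \<Rightarrow> bool" where
  "D_generator M Z \<longleftrightarrow>
     prob_space M \<and> Z \<in> borel_measurable M \<and>
     (\<forall>i. (AE w in M. 0 \<le> Z w $ i) \<and>
          integrable M (\<lambda>w. Z w $ i) \<and> integral\<^sup>L M (\<lambda>w. Z w $ i) = 1)"

definition generated_norm :: "'a measure \<Rightarrow> ('a \<Rightarrow> real ^ 'n) \<Rightarrow> real ^ 'n \<Rightarrow> real" where
  "generated_norm M Z x = integral\<^sup>L M (\<lambda>w. MAX i. \<bar>x $ i\<bar> * Z w $ i)"

text \<open>
  A formula cannot quantify over the type of the sample space, so it is taken to be \<open>real ^ 'n\<close>,
  which carries the law of every generator: see \<open>is_D_norm_generated_norm\<close>.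
\<close>
definition is_D_norm :: "(real ^ 'n \<Rightarrow> real) \<Rightarrow> bool" where
  "is_D_norm N \<longleftrightarrow>
     (\<exists>(M :: (real ^ 'n) measure) Z. D_generator M Z \<and> N = generated_norm M Z)"

definition cmult :: "real ^ 'n \<Rightarrow> real ^ 'n \<Rightarrow> real ^ 'n" where
  "cmult x y = (\<chi> i. x $ i * y $ i)"

text \<open>
  Again the sample space is one that carries the joint law of every pair of generators.
  That the description is unambiguous, and independent of the sample space, is
  \<open>D_norm_product_generated_norm\<close> (with \<open>ex_indep_D_generators\<close> for existence).
\<close>
definition D_norm_product ::
  "(real ^ 'n \<Rightarrow> real) \<Rightarrow> (real ^ 'n \<Rightarrow> real) \<Rightarrow> real ^ 'n \<Rightarrow> real" where
  "D_norm_product N1 N2 =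
     (THE N. \<exists>(M :: ((real ^ 'n) \<times> (real ^ 'n)) measure) Z1 Z2.
        D_generator M Z1 \<and> D_generator M Z2 \<and>
        N1 = generated_norm M Z1 \<and> N2 = generated_norm M Z2 \<and>
        prob_space.indep_var M borel Z1 borel Z2 \<and>
        N = generated_norm M (\<lambda>w. cmult (Z1 w) (Z2 w)))"

definition idempotent_D_norm :: "(real ^ 'n \<Rightarrow> real) \<Rightarrow> bool" where
  "idempotent_D_norm N \<longleftrightarrow> is_D_norm N \<and> D_norm_product N N = N"

definition bivariate_projection ::
  "(real ^ 'n \<Rightarrow> real) \<Rightarrow> 'n \<Rightarrow> 'n \<Rightarrow> real ^ 2 \<Rightarrow> real" where
  "bivariate_projection N i j v = N (v $ 1 *\<^sub>R axis i 1 + v $ 2 *\<^sub>R axis j 1)"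

text \<open>
  The frame is the family \<open>A 1, ..., A K\<close>; the empty frame is \<open>K = 0\<close>. The sup-norm on
  \<open>real ^ 2\<close> is \<open>infnorm\<close>; it is symmetric, so pairs \<open>i \<noteq> j\<close> stand for pairs \<open>i < j\<close>.
\<close>
definition complete_dependence_frame ::
  "(real ^ 'n \<Rightarrow> real) \<Rightarrow> nat \<Rightarrow> (nat \<Rightarrow> 'n set) \<Rightarrow> bool" where
  "complete_dependence_frame N K A \<longleftrightarrow>
     (if \<exists>i j. i \<noteq> j \<and> bivariate_projection N i j = infnorm
      then 1 \<le> K \<and> K < CARD('n) \<and>
           (\<forall>k\<in>{1..K}. A k \<noteq> {} \<and> 2 \<le> card (A k)) \<and> disjoint_family_on A {1..K} \<and>
           (\<forall>k\<in>{1..K}. \<forall>x. N (\<Sum>i\<in>A k. x $ i *\<^sub>R axis i 1) = (MAX i\<in>A k. \<bar>x $ i\<bar>)) \<and>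
           (\<forall>B. 2 \<le> card B \<and> (\<forall>k\<in>{1..K}. \<not> B \<subseteq> A k) \<longrightarrow>
                \<not> (\<forall>x. N (\<Sum>i\<in>B. x $ i *\<^sub>R axis i 1) = (MAX i\<in>B. \<bar>x $ i\<bar>)))
      else K = 0)"


subsection \<open>Independence of the choice of generators\<close>

lemma measurable_vec_nth [measurable]:
  "(\<lambda>x::real ^ 'n. x $ i) \<in> borel_measurable borel"
  by (intro borel_measurable_continuous_onI continuous_intros)

lemma measurable_vec_lambda [measurable (raw)]:
  assumes "\<And>i. f i \<in> borel_measurable M"
  shows "(\<lambda>w. (\<chi> i. f i w) :: real ^ 'n) \<in> borel_measurable M"
  using assms by (subst borel_measurable_euclidean_space) (auto simp: Basis_vec_def inner_axis)

lemma measurable_weighted_max [measurable (raw)]: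
  fixes Z :: "'a \<Rightarrow> real ^ 'n"
  assumes [measurable]: "Z \<in> borel_measurable M"
  shows "(\<lambda>w. MAX i. \<bar>x $ i\<bar> * Z w $ i) \<in> borel_measurable M"
  by (intro borel_measurable_Max) (auto intro!: borel_measurable_times
      measurable_compose[OF assms measurable_vec_nth])

lemma D_generator_AE_nonneg:
  fixes Z :: "'a \<Rightarrow> real ^ 'n"
  assumes "D_generator M Z"
  shows "AE w in M. \<forall>i. 0 \<le> Z w $ i"
  using assms by (subst AE_all_countable) (simp add: D_generator_def)

lemma weighted_max_nonneg:
  fixes z :: "real ^ 'n"
  assumes "\<forall>i. 0 \<le> z $ i"
  shows "0 \<le> (MAX i. \<bar>x $ i\<bar> * z $ i)"
  using assms by (subst Max_ge_iff) auto

lemma generated_norm_eq_nn: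
  fixes Z :: "'a \<Rightarrow> real ^ 'n"
  assumes "Z \<in> borel_measurable M" "AE w in M. \<forall>i. 0 \<le> Z w $ i"
  shows "generated_norm M Z x = enn2real (\<integral>\<^sup>+ w. ennreal (MAX i. \<bar>x $ i\<bar> * Z w $ i) \<partial>M)"
  unfolding generated_norm_def
  by (rule integral_eq_nn_integral)
     (use assms weighted_max_nonneg in \<open>auto intro!: measurable_weighted_max elim!: eventually_mono\<close>)

lemma D_generator_nn:
  fixes Z :: "'a \<Rightarrow> real ^ 'n"
  assumes "D_generator M Z"
  shows "(\<integral>\<^sup>+ w. ennreal (MAX i. \<bar>x $ i\<bar> * Z w $ i) \<partial>M) = ennreal (generated_norm M Z x)"
  unfolding generated_norm_def
proof (rule nn_integral_eq_integral)
  have Z: "Z \<in> borel_measurable M" and int: "\<And>i. integrable M (\<lambda>w. Z w $ i)"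
    using assms by (auto simp: D_generator_def)
  show "AE w in M. 0 \<le> (MAX i. \<bar>x $ i\<bar> * Z w $ i)"
    using D_generator_AE_nonneg[OF assms] weighted_max_nonneg by (auto elim!: eventually_mono)
  show "integrable M (\<lambda>w. MAX i. \<bar>x $ i\<bar> * Z w $ i)"
  proof (rule Bochner_Integration.integrable_bound)
    show "integrable M (\<lambda>w. \<Sum>i\<in>UNIV. \<bar>x $ i\<bar> * Z w $ i)"
      using int by auto
    show "AE w in M. norm (MAX i. \<bar>x $ i\<bar> * Z w $ i) \<le> norm (\<Sum>i\<in>UNIV. \<bar>x $ i\<bar> * Z w $ i)"
      using D_generator_AE_nonneg[OF assms]
    proof (rule eventually_mono)
      fix w assume nn: "\<forall>i. 0 \<le> Z w $ i"
      have "(MAX i. \<bar>x $ i\<bar> * Z w $ i) \<le> (\<Sum>i\<in>UNIV. \<bar>x $ i\<bar> * Z w $ i)"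
        using nn by (subst Max_le_iff) (auto intro!: member_le_sum)
      then show "norm (MAX i. \<bar>x $ i\<bar> * Z w $ i) \<le> norm (\<Sum>i\<in>UNIV. \<bar>x $ i\<bar> * Z w $ i)"
        using weighted_max_nonneg[OF nn, of x] unfolding real_norm_def by linarith
    qed
  qed (use Z in measurable)
qed

lemma D_generator_distr:
  fixes Z :: "'a \<Rightarrow> real ^ 'n"
  assumes "f \<in> measurable M M'" and Z: "Z \<in> borel_measurable M'" and "prob_space M"
  shows "D_generator (distr M M' f) Z \<longleftrightarrow> D_generator M (\<lambda>w. Z (f w))"
    and "generated_norm (distr M M' f) Z = generated_norm M (\<lambda>w. Z (f w))"
proof -
  interpret prob_space M by fact
  note [measurable] = assms(1,2)
  have nth [measurable]: "(\<lambda>w. Z w $ i) \<in> borel_measurable M'" for i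
    by (rule measurable_compose[OF Z measurable_vec_nth])
  have ps: "prob_space (distr M M' f)" by (rule prob_space_distr) fact
  show "D_generator (distr M M' f) Z \<longleftrightarrow> D_generator M (\<lambda>w. Z (f w))"
    using assms ps by (simp add: D_generator_def integrable_distr_eq integral_distr AE_distr_iff)
  show "generated_norm (distr M M' f) Z = generated_norm M (\<lambda>w. Z (f w))"
    by (rule ext) (simp add: generated_norm_def integral_distr)
qed

theorem is_D_norm_generated_norm:
  fixes Z :: "'a \<Rightarrow> real ^ 'n"
  assumes "D_generator M Z"
  shows "is_D_norm (generated_norm M Z)"
proof -
  have "Z \<in> measurable M borel" "prob_space M" using assms by (auto simp: D_generator_def)
  from D_generator_distr[OF this(1) _ this(2), of "\<lambda>x. x"] assms
  have "D_generator (distr M borel Z) (\<lambda>x. x)"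
    and "generated_norm M Z = generated_norm (distr M borel Z) (\<lambda>x. x)" by simp_all
  then show ?thesis unfolding is_D_norm_def by blast
qed

lemma generated_norm_cmult_nn:
  fixes Z1 Z2 :: "'a \<Rightarrow> real ^ 'n"
  assumes g: "D_generator M Z1" "D_generator M Z2"
    and ind: "prob_space.indep_var M borel Z1 borel Z2"
  shows "generated_norm M (\<lambda>w. cmult (Z1 w) (Z2 w)) x =
           enn2real (\<integral>\<^sup>+ w. ennreal (generated_norm M Z2 (cmult x (Z1 w))) \<partial>M)"
    and "generated_norm M (\<lambda>w. cmult (Z1 w) (Z2 w)) x =
           enn2real (\<integral>\<^sup>+ w. ennreal (generated_norm M Z1 (cmult x (Z2 w))) \<partial>M)"
proof -
  interpret prob_space M using g by (simp add: D_generator_def)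
  have Z [measurable]: "Z1 \<in> borel_measurable M" "Z2 \<in> borel_measurable M"
    using g by (auto simp: D_generator_def)
  have [measurable]: "(\<lambda>w. Z1 w $ i) \<in> borel_measurable M"
    "(\<lambda>w. Z2 w $ i) \<in> borel_measurable M" for i
    by (rule measurable_compose[OF _ measurable_vec_nth], measurable)+
  let ?P = "distr M borel Z1" and ?Q = "distr M borel Z2"
  interpret P: prob_space ?P by (rule prob_space_distr) measurable
  interpret Q: prob_space ?Q by (rule prob_space_distr) measurable
  interpret PQ: pair_sigma_finite ?P ?Q ..
  have joint: "?P \<Otimes>\<^sub>M ?Q = distr M (borel \<Otimes>\<^sub>M borel) (\<lambda>w. (Z1 w, Z2 w))"
    using ind by (simp add: indep_var_distribution_eq)
  define F where "F = (\<lambda>(a::real^'n, b::real^'n). ennreal (MAX i. \<bar>x $ i\<bar> * cmult a b $ i))"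
  have F [measurable]: "F \<in> borel_measurable (borel \<Otimes>\<^sub>M borel)"
    unfolding F_def case_prod_beta cmult_def
    by (intro measurable_compose[OF _ measurable_ennreal] measurable_weighted_max
          measurable_vec_lambda borel_measurable_times
          measurable_compose[OF measurable_fst measurable_vec_nth]
          measurable_compose[OF measurable_snd measurable_vec_nth])
  have F': "F \<in> borel_measurable (?P \<Otimes>\<^sub>M ?Q)" by simp
  have swap: "(\<lambda>(a, b). F (b, a)) \<in> borel_measurable (borel \<Otimes>\<^sub>M borel)" by simp
  have nn: "AE w in M. \<forall>i. 0 \<le> cmult (Z1 w) (Z2 w) $ i"
    using D_generator_AE_nonneg[OF g(1)] D_generator_AE_nonneg[OF g(2)]
    by eventually_elim (simp add: cmult_def)
  have "(\<lambda>w. cmult (Z1 w) (Z2 w)) \<in> borel_measurable M"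
    unfolding cmult_def by measurable
  from generated_norm_eq_nn[OF this nn, of x]
  have "generated_norm M (\<lambda>w. cmult (Z1 w) (Z2 w)) x = enn2real (\<integral>\<^sup>+ w. F (Z1 w, Z2 w) \<partial>M)"
    by (simp add: F_def)
  also have "(\<integral>\<^sup>+ w. F (Z1 w, Z2 w) \<partial>M) = (\<integral>\<^sup>+ p. F p \<partial>(?P \<Otimes>\<^sub>M ?Q))"
    unfolding joint by (subst nn_integral_distr) auto
  finally have *: "generated_norm M (\<lambda>w. cmult (Z1 w) (Z2 w)) x =
      enn2real (\<integral>\<^sup>+ p. F p \<partial>(?P \<Otimes>\<^sub>M ?Q))" .
  have "(\<integral>\<^sup>+ p. F p \<partial>(?P \<Otimes>\<^sub>M ?Q)) = (\<integral>\<^sup>+ a. \<integral>\<^sup>+ b. F (a, b) \<partial>?Q \<partial>?P)"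
    by (rule Q.nn_integral_fst[OF F', symmetric])
  also have "\<dots> = (\<integral>\<^sup>+ w. \<integral>\<^sup>+ b. F (Z1 w, b) \<partial>?Q \<partial>M)"
    by (subst nn_integral_distr) auto
  also have "\<dots> = (\<integral>\<^sup>+ w. ennreal (generated_norm M Z2 (cmult x (Z1 w))) \<partial>M)"
  proof (rule nn_integral_cong_AE, use D_generator_AE_nonneg[OF g(1)] in \<open>rule eventually_mono\<close>)
    fix w assume nn: "\<forall>i. 0 \<le> Z1 w $ i"
    have "(\<integral>\<^sup>+ b. F (Z1 w, b) \<partial>?Q) = (\<integral>\<^sup>+ v. F (Z1 w, Z2 v) \<partial>M)"
      by (subst nn_integral_distr) auto
    also have "\<dots> = (\<integral>\<^sup>+ v. ennreal (MAX i. \<bar>cmult x (Z1 w) $ i\<bar> * Z2 v $ i) \<partial>M)"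
      using nn by (simp add: F_def cmult_def abs_mult mult.assoc)
    also have "\<dots> = ennreal (generated_norm M Z2 (cmult x (Z1 w)))"
      by (rule D_generator_nn[OF g(2)])
    finally show "(\<integral>\<^sup>+ b. F (Z1 w, b) \<partial>?Q) = ennreal (generated_norm M Z2 (cmult x (Z1 w)))" .
  qed
  finally show "generated_norm M (\<lambda>w. cmult (Z1 w) (Z2 w)) x =
      enn2real (\<integral>\<^sup>+ w. ennreal (generated_norm M Z2 (cmult x (Z1 w))) \<partial>M)"
    using * by simp
  have "(\<integral>\<^sup>+ p. F p \<partial>(?P \<Otimes>\<^sub>M ?Q)) = (\<integral>\<^sup>+ b. \<integral>\<^sup>+ a. F (a, b) \<partial>?P \<partial>?Q)"
    by (rule PQ.nn_integral_snd[OF F', symmetric])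
  also have "\<dots> = (\<integral>\<^sup>+ w. \<integral>\<^sup>+ a. F (a, Z2 w) \<partial>?P \<partial>M)"
    by (subst nn_integral_distr) auto
  also have "\<dots> = (\<integral>\<^sup>+ w. ennreal (generated_norm M Z1 (cmult x (Z2 w))) \<partial>M)"
  proof (rule nn_integral_cong_AE, use D_generator_AE_nonneg[OF g(2)] in \<open>rule eventually_mono\<close>)
    fix w assume nn: "\<forall>i. 0 \<le> Z2 w $ i"
    have "(\<integral>\<^sup>+ a. F (a, Z2 w) \<partial>?P) = (\<integral>\<^sup>+ v. F (Z1 v, Z2 w) \<partial>M)"
      by (subst nn_integral_distr) auto
    also have "\<dots> = (\<integral>\<^sup>+ v. ennreal (MAX i. \<bar>cmult x (Z2 w) $ i\<bar> * Z1 v $ i) \<partial>M)"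
      using nn by (simp add: F_def cmult_def abs_mult mult_ac)
    also have "\<dots> = ennreal (generated_norm M Z1 (cmult x (Z2 w)))"
      by (rule D_generator_nn[OF g(1)])
    finally show "(\<integral>\<^sup>+ a. F (a, Z2 w) \<partial>?P) = ennreal (generated_norm M Z1 (cmult x (Z2 w)))" .
  qed
  finally show "generated_norm M (\<lambda>w. cmult (Z1 w) (Z2 w)) x =
      enn2real (\<integral>\<^sup>+ w. ennreal (generated_norm M Z1 (cmult x (Z2 w))) \<partial>M)"
    using * by simp
qed

lemma indep_generators_of_laws:
  fixes Z1 :: "'a \<Rightarrow> real ^ 'n" and Z2 :: "'b \<Rightarrow> real ^ 'n"
  assumes g: "D_generator M1 Z1" "D_generator M2 Z2"
  defines "M \<equiv> distr M1 borel Z1 \<Otimes>\<^sub>M distr M2 borel Z2"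
  shows "D_generator M fst" "D_generator M snd"
    and "generated_norm M fst = generated_norm M1 Z1"
    and "generated_norm M snd = generated_norm M2 Z2"
    and "prob_space.indep_var M borel fst borel snd"
    and "distr M borel fst = distr M1 borel Z1"
    and "distr M borel snd = distr M2 borel Z2"
proof -
  interpret M1: prob_space M1 using g by (simp add: D_generator_def)
  interpret M2: prob_space M2 using g by (simp add: D_generator_def)
  have Z [measurable]: "Z1 \<in> borel_measurable M1" "Z2 \<in> borel_measurable M2"
    using g by (auto simp: D_generator_def)
  let ?P = "distr M1 borel Z1" and ?Q = "distr M2 borel Z2"
  interpret P: prob_space ?P by (rule M1.prob_space_distr) measurable
  interpret Q: prob_space ?Q by (rule M2.prob_space_distr) measurable
  interpret PQ: pair_prob_space ?P ?Q ..
  have fst: "distr M borel fst = ?P"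
    using Q.distr_pair_fst[of ?P] unfolding M_def by (simp cong: distr_cong)
  have snd: "distr M borel snd = ?Q"
  proof -
    have "distr M borel snd = distr (distr (?Q \<Otimes>\<^sub>M ?P) (?P \<Otimes>\<^sub>M ?Q) (\<lambda>(x, y). (y, x))) borel snd"
      unfolding M_def by (subst PQ.distr_pair_swap) simp
    also have "\<dots> = distr (?Q \<Otimes>\<^sub>M ?P) borel fst"
      by (subst distr_distr) (auto intro!: distr_cong)
    also have "\<dots> = ?Q"
      using P.distr_pair_fst[of ?Q] by (simp cong: distr_cong)
    finally show ?thesis .
  qed
  have M: "prob_space M" unfolding M_def by (rule PQ.prob_space_axioms)
  have meas: "fst \<in> measurable M borel" "snd \<in> measurable M borel"
    unfolding M_def by measurable
  have id: "(\<lambda>x. x) \<in> borel_measurable borel" by simp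
  note F = D_generator_distr[OF meas(1) id M] and S = D_generator_distr[OF meas(2) id M]
  note A = D_generator_distr[OF Z(1) id M1.prob_space_axioms]
   and B = D_generator_distr[OF Z(2) id M2.prob_space_axioms]
  show "distr M borel fst = ?P" "distr M borel snd = ?Q" by fact+
  show "D_generator M fst" using F(1) A(1) g(1) fst by simp
  show "D_generator M snd" using S(1) B(1) g(2) snd by simp
  show "generated_norm M fst = generated_norm M1 Z1" using F(2) A(2) fst by simp
  show "generated_norm M snd = generated_norm M2 Z2" using S(2) B(2) snd by simp
  have sets: "sets (borel \<Otimes>\<^sub>M borel) = sets M"
    unfolding M_def by (intro sets_pair_measure_cong) simp_all
  have "distr M (borel \<Otimes>\<^sub>M borel) (\<lambda>w. (fst w, snd w)) = M"
    unfolding prod.collapse by (rule distr_id2[OF sets])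
  then show "prob_space.indep_var M borel fst borel snd"
    unfolding prob_space.indep_var_distribution_eq[OF M] fst snd
    using meas by (auto simp: M_def)
qed

lemma ex_indep_D_generators:
  fixes N1 N2 :: "real ^ 'n \<Rightarrow> real"
  assumes "is_D_norm N1" "is_D_norm N2"
  shows "\<exists>(M :: ((real ^ 'n) \<times> (real ^ 'n)) measure) Z1 Z2.
    D_generator M Z1 \<and> D_generator M Z2 \<and>
    N1 = generated_norm M Z1 \<and> N2 = generated_norm M Z2 \<and>
    prob_space.indep_var M borel Z1 borel Z2"
proof -
  obtain M1 :: "(real ^ 'n) measure" and Z1 where 1: "D_generator M1 Z1" "N1 = generated_norm M1 Z1"
    using assms(1) by (auto simp: is_D_norm_def)
  obtain M2 :: "(real ^ 'n) measure" and Z2 where 2: "D_generator M2 Z2" "N2 = generated_norm M2 Z2"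
    using assms(2) by (auto simp: is_D_norm_def)
  let ?M = "distr M1 borel Z1 \<Otimes>\<^sub>M distr M2 borel Z2"
  note laws = indep_generators_of_laws[OF 1(1) 2(1)]
  have "D_generator ?M fst \<and> D_generator ?M snd \<and>
    N1 = generated_norm ?M fst \<and> N2 = generated_norm ?M snd \<and>
    prob_space.indep_var ?M borel fst borel snd"
    using laws(1-5) 1(2) 2(2) by simp
  then show ?thesis by blast
qed

lemma generated_norm_measurable:
  fixes Z :: "'a \<Rightarrow> real ^ 'n"
  assumes "D_generator M Z"
  shows "(\<lambda>z. ennreal (generated_norm M Z (cmult x z))) \<in> borel_measurable borel"
proof -
  interpret prob_space M using assms by (simp add: D_generator_def)
  have Z [measurable]: "Z \<in> borel_measurable M" using assms by (simp add: D_generator_def)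
  have "(\<lambda>p. MAX i. \<bar>cmult x (fst p) $ i\<bar> * Z (snd p) $ i) \<in> borel_measurable (borel \<Otimes>\<^sub>M M)"
    unfolding cmult_def
    by (intro borel_measurable_Max)
       (auto intro!: borel_measurable_times borel_measurable_abs
          measurable_compose[OF measurable_fst measurable_vec_nth]
          measurable_compose[OF measurable_compose[OF measurable_snd Z] measurable_vec_nth])
  then show ?thesis
    unfolding generated_norm_def
    by (intro measurable_compose[OF _ measurable_ennreal] borel_measurable_lebesgue_integral)
       (simp add: case_prod_beta)
qed

lemma nn_integral_law:
  assumes "X \<in> borel_measurable K" "f \<in> borel_measurable borel"
  shows "(\<integral>\<^sup>+ w. f (X w) \<partial>K) = (\<integral>\<^sup>+ a. f a \<partial>distr K borel X)"
  using assms by (subst nn_integral_distr) auto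

lemma generated_norm_cmult_unique:
  fixes Z1 Z2 :: "'a \<Rightarrow> real ^ 'n" and Y1 Y2 :: "'b \<Rightarrow> real ^ 'n"
  assumes Z: "D_generator M Z1" "D_generator M Z2" "prob_space.indep_var M borel Z1 borel Z2"
    and Y: "D_generator L Y1" "D_generator L Y2" "prob_space.indep_var L borel Y1 borel Y2"
    and eq: "generated_norm M Z1 = generated_norm L Y1" "generated_norm M Z2 = generated_norm L Y2"
  shows "generated_norm M (\<lambda>w. cmult (Z1 w) (Z2 w)) = generated_norm L (\<lambda>w. cmult (Y1 w) (Y2 w))"
proof
  fix x
  txt \<open>Pass through an independent pair with the laws of \<open>Z1\<close> and \<open>Y2\<close>.\<close>
  let ?P = "distr M borel Z1" and ?Q = "distr L borel Y2"
  let ?M = "?P \<Otimes>\<^sub>M ?Q"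
  note mix = indep_generators_of_laws[OF Z(1) Y(2)]
  have meas: "Z1 \<in> borel_measurable M" "Y2 \<in> borel_measurable L"
    "fst \<in> borel_measurable ?M" "snd \<in> borel_measurable ?M"
    using Z(1) Y(2) mix(1,2) by (auto simp: D_generator_def)
  note m2 = generated_norm_measurable[OF Z(2), of x] and m1 = generated_norm_measurable[OF Z(1), of x]
  note law2 = nn_integral_law[OF meas(1) m2] nn_integral_law[OF meas(3) m2]
   and law1 = nn_integral_law[OF meas(2) m1] nn_integral_law[OF meas(4) m1]
  have "(\<integral>\<^sup>+ w. ennreal (generated_norm M Z2 (cmult x (Z1 w))) \<partial>M) =
        (\<integral>\<^sup>+ w. ennreal (generated_norm M Z2 (cmult x (fst w))) \<partial>?M)"
    unfolding law2 mix(6) ..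
  then have "generated_norm M (\<lambda>w. cmult (Z1 w) (Z2 w)) x =
      generated_norm ?M (\<lambda>w. cmult (fst w) (snd w)) x"
    using generated_norm_cmult_nn(1)[OF Z] generated_norm_cmult_nn(1)[OF mix(1,2,5)] mix(4) eq(2)
    by simp
  moreover have "(\<integral>\<^sup>+ w. ennreal (generated_norm M Z1 (cmult x (Y2 w))) \<partial>L) =
        (\<integral>\<^sup>+ w. ennreal (generated_norm M Z1 (cmult x (snd w))) \<partial>?M)"
    unfolding law1 mix(7) ..
  then have "generated_norm ?M (\<lambda>w. cmult (fst w) (snd w)) x =
      generated_norm L (\<lambda>w. cmult (Y1 w) (Y2 w)) x"
    using generated_norm_cmult_nn(2)[OF Y] generated_norm_cmult_nn(2)[OF mix(1,2,5)] mix(3) eq(1)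
    by simp
  ultimately show "generated_norm M (\<lambda>w. cmult (Z1 w) (Z2 w)) x =
      generated_norm L (\<lambda>w. cmult (Y1 w) (Y2 w)) x" by simp
qed

theorem D_norm_product_generated_norm:
  fixes Z1 Z2 :: "'a \<Rightarrow> real ^ 'n"
  assumes Z: "D_generator M Z1" "D_generator M Z2" "prob_space.indep_var M borel Z1 borel Z2"
  shows "D_norm_product (generated_norm M Z1) (generated_norm M Z2) =
           generated_norm M (\<lambda>w. cmult (Z1 w) (Z2 w))"
proof -
  obtain L :: "((real ^ 'n) \<times> (real ^ 'n)) measure" and Y1 Y2 where
    Y: "D_generator L Y1" "D_generator L Y2" "prob_space.indep_var L borel Y1 borel Y2"
    and eq: "generated_norm M Z1 = generated_norm L Y1" "generated_norm M Z2 = generated_norm L Y2"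
    using ex_indep_D_generators[OF is_D_norm_generated_norm[OF Z(1)] is_D_norm_generated_norm[OF Z(2)]]
    by auto
  show ?thesis
    unfolding D_norm_product_def
  proof (rule the_equality)
    show "\<exists>(L :: ((real ^ 'n) \<times> (real ^ 'n)) measure) Y1 Y2.
        D_generator L Y1 \<and> D_generator L Y2 \<and>
        generated_norm M Z1 = generated_norm L Y1 \<and> generated_norm M Z2 = generated_norm L Y2 \<and>
        prob_space.indep_var L borel Y1 borel Y2 \<and>
        generated_norm M (\<lambda>w. cmult (Z1 w) (Z2 w)) = generated_norm L (\<lambda>w. cmult (Y1 w) (Y2 w))"
      using Y eq generated_norm_cmult_unique[OF Z Y eq] by blast
  next
    fix N
    assume "\<exists>(L :: ((real ^ 'n) \<times> (real ^ 'n)) measure) Y1 Y2.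
        D_generator L Y1 \<and> D_generator L Y2 \<and>
        generated_norm M Z1 = generated_norm L Y1 \<and> generated_norm M Z2 = generated_norm L Y2 \<and>
        prob_space.indep_var L borel Y1 borel Y2 \<and>
        N = generated_norm L (\<lambda>w. cmult (Y1 w) (Y2 w))"
    then show "N = generated_norm M (\<lambda>w. cmult (Z1 w) (Z2 w))"
      by (elim exE conjE) (simp only: generated_norm_cmult_unique[OF Z, symmetric])
  qed
qed

end

theory Submission
  imports Defs
begin

text \<open>
  Let \<open>Z\<close> generate the norm, with an independent copy \<open>Z'\<close>. For \<open>i \<noteq> j\<close> put
  \<open>m a b = E (min (a Z\<^sub>i) (b Z\<^sub>j))\<close> and \<open>h = E (sqrt (Z\<^sub>i Z\<^sub>j))\<close>. Idempotence gives
  \<open>m a b = E (m (a Z\<^sub>i) (b Z\<^sub>j))\<close>, so a bound \<open>m a b \<le> c sqrt (a b)\<close> improves itself to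
  \<open>m a b \<le> c h sqrt (a b)\<close>. Hence either \<open>h < 1\<close> and \<open>m = 0\<close>, so that
  \<open>min (Z\<^sub>i) (Z\<^sub>j) = 0\<close> almost surely, or \<open>h \<ge> 1\<close> and
  \<open>E ((sqrt Z\<^sub>i - sqrt Z\<^sub>j)\<^sup>2) = 2 - 2 h \<le> 0\<close>, so that \<open>Z\<^sub>i = Z\<^sub>j\<close> almost surely. The frame
  says which case occurs for which pair, and at most one block of coordinates is nonzero at a time.
  Conversely, a block drawn uniformly from the frame and the remaining singletons, with its
  indicator scaled by the number of blocks, generates the norm in question.
\<close>

section \<open>Dichotomy for a pair of nonnegative random variables of mean 1\<close>

lemma min_le_sqrt_mult:
  fixes u v :: real
  assumes "0 \<le> u" "0 \<le> v"
  shows "min u v \<le> sqrt (u * v)"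
proof (rule real_le_rsqrt)
  have "min u v * min u v \<le> u * v"
    using assms by (intro mult_mono) auto
  then show "(min u v)\<^sup>2 \<le> u * v" by (simp add: power2_eq_square)
qed

lemma sqrt_mult_le_add:
  fixes u v :: real
  assumes "0 \<le> u" "0 \<le> v"
  shows "sqrt (u * v) \<le> u + v"
proof -
  have "sqrt (u * v) \<le> (u + v) / 2" by (rule arith_geo_mean_sqrt) fact+
  also have "\<dots> \<le> u + v" using assms by simp
  finally show ?thesis .
qed

text \<open>Hypothesis \<open>stable\<close> is idempotence on vectors with two nonzero entries
  \<open>a\<close>, \<open>b\<close>: integrating over \<open>v\<close> for fixed \<open>w\<close>
  plays the role of an independent copy of the pair.\<close>

lemma (in prob_space) product_stable_pair:
  fixes X Y :: "'a \<Rightarrow> real"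
  assumes X: "integrable M X" "AE w in M. 0 \<le> X w" "expectation X = 1"
    and Y: "integrable M Y" "AE w in M. 0 \<le> Y w" "expectation Y = 1"
    and stable: "\<And>a b. 0 \<le> a \<Longrightarrow> 0 \<le> b \<Longrightarrow>
      (\<integral>w. (\<integral>v. max (a * X w * X v) (b * Y w * Y v) \<partial>M) \<partial>M) =
      (\<integral>w. max (a * X w) (b * Y w) \<partial>M)"
  shows "(AE w in M. X w = Y w) \<or> (AE w in M. min (X w) (Y w) = 0)"
proof -
  note [simp] = X(1) Y(1)
  have [measurable]: "X \<in> borel_measurable M" "Y \<in> borel_measurable M"
    by (rule borel_measurable_integrable, fact)+
  define m where "m = (\<lambda>a b. \<integral>v. min (a * X v) (b * Y v) \<partial>M)"
  define h where "h = (\<integral>w. sqrt (X w * Y w) \<partial>M)"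
  have nn: "AE w in M. 0 \<le> X w \<and> 0 \<le> Y w" using X(2) Y(2) by eventually_elim simp
  have int_sqrt: "integrable M (\<lambda>w. sqrt (X w * Y w))"
  proof (rule Bochner_Integration.integrable_bound)
    show "integrable M (\<lambda>w. X w + Y w)" by simp
    show "AE w in M. norm (sqrt (X w * Y w)) \<le> norm (X w + Y w)"
      using nn by eventually_elim (simp add: sqrt_mult_le_add)
  qed measurable
  \<comment> \<open>Since \<open>min u v = u + v - max u v\<close> and both means are 1,
    \<open>stable\<close> for the maximum carries over to \<open>m\<close>.\<close>
  have m_max: "m a b = a + b - (\<integral>v. max (a * X v) (b * Y v) \<partial>M)" for a b
  proof -
    have "m a b = (\<integral>v. a * X v + b * Y v - max (a * X v) (b * Y v) \<partial>M)"
      unfolding m_def by (intro Bochner_Integration.integral_cong) auto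
    then show ?thesis by (simp add: X(3) Y(3))
  qed
  have m_nonneg: "0 \<le> m a b" if "0 \<le> a" "0 \<le> b" for a b
    unfolding m_def using nn that by (intro integral_nonneg_AE) auto
  have m_le: "m a b \<le> a" for a b
  proof -
    have "m a b \<le> (\<integral>v. a * X v \<partial>M)"
      unfolding m_def by (intro integral_mono) auto
    then show ?thesis by (simp add: X(3))
  qed
  have int_m: "integrable M (\<lambda>w. m (a * X w) (b * Y w))" if "0 \<le> a" "0 \<le> b" for a b
  proof (rule Bochner_Integration.integrable_bound)
    show "integrable M (\<lambda>w. a * X w)" by simp
    show "(\<lambda>w. m (a * X w) (b * Y w)) \<in> borel_measurable M"
      unfolding m_def by measurable
    show "AE w in M. norm (m (a * X w) (b * Y w)) \<le> norm (a * X w)"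
      using nn by eventually_elim (use that m_nonneg m_le in simp)
  qed
  have m_stable: "m a b = (\<integral>w. m (a * X w) (b * Y w) \<partial>M)" if "0 \<le> a" "0 \<le> b" for a b
  proof -
    \<comment> \<open>Splitting the outer integral needs an integrable inner integral of the
      maximum. By \<open>m_max\<close> it is the difference of \<open>a * X w + b * Y w\<close> and
      \<open>m (a * X w) (b * Y w)\<close>.\<close>
    have "integrable M (\<lambda>w. a * X w + b * Y w - m (a * X w) (b * Y w))"
      using int_m[OF that] by simp
    then have "integrable M (\<lambda>w. \<integral>v. max (a * X w * X v) (b * Y w * Y v) \<partial>M)"
      by (simp add: m_max)
    then show ?thesis
      using stable[OF that] by (simp add: m_max X(3) Y(3))
  qed
  \<comment> \<open>The first factor \<open>h\<close> comes from integrating the bound of the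
    minimum by the geometric mean. Each further one comes from \<open>m_stable\<close>, with the
    induction hypothesis applied at the random scales \<open>a * X w\<close> and
    \<open>b * Y w\<close>; hence \<open>a\<close> and \<open>b\<close> are arbitrary.\<close>
  have bound: "m a b \<le> h ^ Suc n * sqrt (a * b)" if "0 \<le> a" "0 \<le> b" for a b n
    using that
  proof (induction n arbitrary: a b)
    case 0
    have "m a b \<le> (\<integral>w. sqrt (a * b) * sqrt (X w * Y w) \<partial>M)"
      unfolding m_def
    proof (rule integral_mono_AE)
      show "AE w in M. min (a * X w) (b * Y w) \<le> sqrt (a * b) * sqrt (X w * Y w)"
        using nn
      proof eventually_elim
        case (elim w)
        then show ?case
          using min_le_sqrt_mult[of "a * X w" "b * Y w"] 0
          by (simp add: real_sqrt_mult mult_ac)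
      qed
    qed (use int_sqrt in auto)
    then show ?case by (simp add: h_def mult_ac)
  next
    case (Suc n)
    have "m a b = (\<integral>w. m (a * X w) (b * Y w) \<partial>M)" by (rule m_stable) fact+
    also have "\<dots> \<le> (\<integral>w. h ^ Suc n * sqrt (a * b) * sqrt (X w * Y w) \<partial>M)"
    proof (rule integral_mono_AE)
      show "AE w in M. m (a * X w) (b * Y w) \<le> h ^ Suc n * sqrt (a * b) * sqrt (X w * Y w)"
        using nn
      proof eventually_elim
        case (elim w)
        then have "m (a * X w) (b * Y w) \<le> h ^ Suc n * sqrt (a * X w * (b * Y w))"
          using Suc.prems by (intro Suc.IH) auto
        then show ?case by (simp add: real_sqrt_mult mult_ac)
      qed
    qed (use int_sqrt int_m[OF Suc.prems] in auto)
    finally show ?case by (simp add: h_def mult_ac)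
  qed
  have h_nonneg: "0 \<le> h"
    unfolding h_def using nn by (intro integral_nonneg_AE) auto
  show ?thesis
  proof (cases "h < 1")
    case True
    have "(\<lambda>n. h ^ Suc n) \<longlonglongrightarrow> 0"
      using True h_nonneg by (intro LIMSEQ_Suc LIMSEQ_realpow_zero)
    then have "m 1 1 \<le> 0"
      using bound[of 1 1] by (intro LIMSEQ_le_const[of "\<lambda>n. h ^ Suc n" 0]) auto
    then have "(\<integral>w. min (X w) (Y w) \<partial>M) = 0"
      using m_nonneg[of 1 1] by (simp add: m_def)
    then show ?thesis
      using nn by (subst (asm) integral_nonneg_eq_0_iff_AE) auto
  next
    case False
    \<comment> \<open>In expanded form the square is visibly integrable with expectation
      \<open>2 - 2 * h\<close>. Being nonnegative with a nonpositive expectation, it vanishes almost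
      surely.\<close>
    have "AE w in M. (sqrt (X w) - sqrt (Y w))\<^sup>2 = X w + Y w - 2 * sqrt (X w * Y w)"
      using nn by eventually_elim (simp add: power2_diff real_sqrt_mult)
    then have AE_nn: "AE w in M. 0 \<le> X w + Y w - 2 * sqrt (X w * Y w)"
      by eventually_elim (metis zero_le_power2)
    have int_diff: "integrable M (\<lambda>w. X w + Y w - 2 * sqrt (X w * Y w))"
      using int_sqrt by simp
    have "(\<integral>w. X w + Y w - 2 * sqrt (X w * Y w) \<partial>M) = 2 - 2 * h"
      using int_sqrt by (simp add: h_def X(3) Y(3))
    then have "(\<integral>w. X w + Y w - 2 * sqrt (X w * Y w) \<partial>M) = 0"
      using False integral_nonneg_AE[OF AE_nn] by simp
    then have "AE w in M. X w + Y w - 2 * sqrt (X w * Y w) = 0"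
      using integral_nonneg_eq_0_iff_AE[OF int_diff AE_nn] by simp
    with nn have "AE w in M. X w = Y w"
    proof eventually_elim
      case (elim w)
      then have "(sqrt (X w) - sqrt (Y w))\<^sup>2 = 0"
        by (simp add: power2_diff real_sqrt_mult)
      then show ?case by simp
    qed
    then show ?thesis ..
  qed
qed

section \<open>Idempotence and restricted coordinates in terms of one generator\<close>

lemma D_norm_product_self:
  fixes Z :: "'a \<Rightarrow> real ^ 'n"
  assumes "D_generator M Z"
  shows "D_norm_product (generated_norm M Z) (generated_norm M Z) x =
    enn2real (\<integral>\<^sup>+ w. ennreal (generated_norm M Z (cmult x (Z w))) \<partial>M)"
proof -
  \<comment> \<open>The projections of this product space are independent with the law of
    \<open>Z\<close>. Integrating out the second one leaves a function of the first alone, whose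
    integral depends only on that law and so can be taken over \<open>M\<close> again.\<close>
  let ?M = "distr M borel Z \<Otimes>\<^sub>M distr M borel Z"
  note laws = indep_generators_of_laws[OF assms assms]
  have meas: "Z \<in> borel_measurable M" "fst \<in> borel_measurable ?M"
    using assms laws(1) by (auto simp: D_generator_def)
  have "D_norm_product (generated_norm M Z) (generated_norm M Z) x =
      enn2real (\<integral>\<^sup>+ w. ennreal (generated_norm M Z (cmult x (fst w))) \<partial>?M)"
    using D_norm_product_generated_norm[OF laws(1,2,5)] generated_norm_cmult_nn(1)[OF laws(1,2,5)]
    unfolding laws(3,4) by simp
  then show ?thesis
    unfolding nn_integral_law[OF meas(1) generated_norm_measurable[OF assms]]
      nn_integral_law[OF meas(2) generated_norm_measurable[OF assms]] laws(6) .
qed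

lemma sum_scaleR_axis:
  fixes x :: "real ^ 'n"
  shows "(\<Sum>i\<in>B. x $ i *\<^sub>R axis i 1) = (\<chi> i. if i \<in> B then x $ i else 0)"
  by (simp add: vec_eq_iff axis_def if_distrib cong: if_cong)

lemma Max_restrict:
  fixes f :: "'n::finite \<Rightarrow> real"
  assumes "B \<noteq> {}" "\<And>i. i \<in> B \<Longrightarrow> 0 \<le> f i" "\<And>i. i \<notin> B \<Longrightarrow> f i = 0"
  shows "(MAX i. f i) = (MAX i\<in>B. f i)"
proof (rule antisym)
  show "(MAX i. f i) \<le> (MAX i\<in>B. f i)"
  proof (subst Max_le_iff; clarsimp)
    fix i
    \<comment> \<open>An index outside \<open>B\<close> has value 0, so any element of
      \<open>B\<close> can stand in for it.\<close>
    obtain j where "j \<in> B" using assms(1) by blast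
    then have "f i \<le> f (if i \<in> B then i else j)" using assms(2,3) by auto
    also have "\<dots> \<le> (MAX i\<in>B. f i)" using \<open>j \<in> B\<close> by (intro Max_ge) auto
    finally show "f i \<le> (MAX i\<in>B. f i)" .
  qed
qed (use assms(1) in \<open>auto intro!: Max_mono\<close>)

lemma Max_mult_right:
  fixes f :: "'i \<Rightarrow> real"
  assumes "finite B" "B \<noteq> {}" "0 \<le> c"
  shows "(MAX i\<in>B. f i * c) = (MAX i\<in>B. f i) * c"
proof -
  have "mono (\<lambda>t. t * c)" using assms(3) by (auto intro!: monoI mult_right_mono)
  from mono_Max_commute[OF this, of "f ` B"] assms show ?thesis
    by (simp add: image_image)
qed

text \<open>The zero entries outside \<open>B\<close> do not affect the maximum, because the
  remaining terms are almost surely nonnegative and \<open>B\<close> is nonempty.\<close>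

lemma generated_norm_restrict:
  fixes Z :: "'a \<Rightarrow> real ^ 'n"
  assumes g: "D_generator M Z" and B: "B \<noteq> {}"
  shows "generated_norm M Z (\<Sum>i\<in>B. x $ i *\<^sub>R axis i 1) =
    (\<integral>w. (MAX i\<in>B. \<bar>x $ i\<bar> * Z w $ i) \<partial>M)"
  unfolding generated_norm_def sum_scaleR_axis
proof (rule integral_cong_AE)
  have [measurable]: "Z \<in> borel_measurable M" using g by (simp add: D_generator_def)
  show "(\<lambda>w. MAX i. \<bar>(\<chi> i. if i \<in> B then x $ i else 0) $ i\<bar> * Z w $ i) \<in> borel_measurable M"
    by measurable
  show "(\<lambda>w. MAX i\<in>B. \<bar>x $ i\<bar> * Z w $ i) \<in> borel_measurable M"
    by (intro borel_measurable_Max) (auto intro!: borel_measurable_times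
      measurable_compose[OF \<open>Z \<in> borel_measurable M\<close> measurable_vec_nth])
  show "AE w in M. (MAX i. \<bar>(\<chi> i. if i \<in> B then x $ i else 0) $ i\<bar> * Z w $ i) =
      (MAX i\<in>B. \<bar>x $ i\<bar> * Z w $ i)"
    using D_generator_AE_nonneg[OF g]
  proof eventually_elim
    case (elim w)
    show ?case
      by (subst Max_restrict[OF B]) (use elim in \<open>auto intro!: arg_cong[of _ _ Max] image_cong\<close>)
  qed
qed

lemma generated_norm_pair:
  fixes Z :: "'a \<Rightarrow> real ^ 'n"
  assumes "D_generator M Z"
  shows "generated_norm M Z (\<Sum>l\<in>{i, j}. x $ l *\<^sub>R axis l 1) =
    (\<integral>w. max (\<bar>x $ i\<bar> * Z w $ i) (\<bar>x $ j\<bar> * Z w $ j) \<partial>M)"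
  by (subst generated_norm_restrict[OF assms]) auto

lemma idempotent_pair:
  fixes Z :: "'a \<Rightarrow> real ^ 'n"
  assumes g: "D_generator M Z" and idem: "idempotent_D_norm (generated_norm M Z)" and "i \<noteq> j"
  shows "(AE w in M. Z w $ i = Z w $ j) \<or> (AE w in M. min (Z w $ i) (Z w $ j) = 0)"
proof -
  interpret prob_space M using g by (simp add: D_generator_def)
  let ?N = "generated_norm M Z"
  have Z [measurable]: "Z \<in> borel_measurable M" using g by (simp add: D_generator_def)
  have [measurable]: "(\<lambda>w. Z w $ i) \<in> borel_measurable M" for i
    by (rule measurable_compose[OF Z measurable_vec_nth])
  show ?thesis
  proof (rule product_stable_pair)
    fix a b :: real
    assume ab: "0 \<le> a" "0 \<le> b"
    \<comment> \<open>Only the entries at \<open>i\<close> and \<open>j\<close> survive in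
      \<open>?x\<close>, so the value \<open>b\<close> at all other indices is immaterial.\<close>
    define x :: "real ^ 'n" where "x = (\<chi> l. if l = i then a else b)"
    let ?x = "\<Sum>l\<in>{i, j}. x $ l *\<^sub>R axis l 1"
    \<comment> \<open>Multiplying by \<open>Z w\<close> keeps the support within
      \<open>{i, j}\<close>, so the inner norm is again an expectation of a maximum of two
      terms.\<close>
    have cm: "?N (cmult ?x (Z w)) = (\<integral>v. max (a * Z w $ i * Z v $ i) (b * Z w $ j * Z v $ j) \<partial>M)"
      if "\<forall>i. 0 \<le> Z w $ i" for w
    proof -
      have "cmult ?x (Z w) = (\<Sum>l\<in>{i, j}. cmult x (Z w) $ l *\<^sub>R axis l 1)"
        unfolding sum_scaleR_axis by (simp add: vec_eq_iff cmult_def)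
      then show ?thesis
        using ab that \<open>i \<noteq> j\<close>
        by (simp only: generated_norm_pair[OF g]) (simp add: cmult_def x_def abs_mult)
    qed
    have N_nonneg: "0 \<le> ?N y" for y
      unfolding generated_norm_def using D_generator_AE_nonneg[OF g]
      by (intro integral_nonneg_AE) (auto elim!: eventually_mono intro: weighted_max_nonneg)
    \<comment> \<open>Measurability is known for the \<open>ennreal\<close> version;
      \<open>enn2real\<close> undoes the embedding because the norm is nonnegative.\<close>
    have meas: "(\<lambda>w. ?N (cmult ?x (Z w))) \<in> borel_measurable M"
    proof -
      have "(\<lambda>w. enn2real (ennreal (?N (cmult ?x (Z w))))) \<in> borel_measurable M"
        by (intro borel_measurable_enn2real measurable_compose[OF Z generated_norm_measurable[OF g]])
      then show ?thesis by (simp add: N_nonneg)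
    qed
    have "(\<integral>w. max (a * Z w $ i) (b * Z w $ j) \<partial>M) = ?N ?x"
      using ab \<open>i \<noteq> j\<close> by (simp only: generated_norm_pair[OF g]) (simp add: x_def)
    also have "\<dots> = D_norm_product ?N ?N ?x"
      using idem by (simp add: idempotent_D_norm_def)
    also have "\<dots> = (\<integral>w. ?N (cmult ?x (Z w)) \<partial>M)"
      unfolding D_norm_product_self[OF g]
      by (rule integral_eq_nn_integral[symmetric]) (use meas N_nonneg in simp_all)
    also have "\<dots> = (\<integral>w. (\<integral>v. max (a * Z w $ i * Z v $ i) (b * Z w $ j * Z v $ j) \<partial>M) \<partial>M)"
    proof (rule integral_cong_AE)
      show "AE w in M. ?N (cmult ?x (Z w)) =
          (\<integral>v. max (a * Z w $ i * Z v $ i) (b * Z w $ j * Z v $ j) \<partial>M)"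
        using D_generator_AE_nonneg[OF g] by eventually_elim (rule cm)
    qed (use meas in measurable)
    finally show "(\<integral>w. (\<integral>v. max (a * Z w $ i * Z v $ i) (b * Z w $ j * Z v $ j) \<partial>M) \<partial>M) =
        (\<integral>w. max (a * Z w $ i) (b * Z w $ j) \<partial>M)" ..
  qed (use g in \<open>auto simp: D_generator_def\<close>)
qed

section \<open>Norms built from a partition of the indices\<close>

lemma partition_on_block_eq:
  assumes "partition_on A P" "B \<in> P" "C \<in> P" "i \<in> B" "i \<in> C"
  shows "B = C"
  using disjointD[OF partition_onD2[OF assms(1)] assms(2,3)] assms(4,5) by blast

text \<open>Both sums of the theorem in one: an index outside the frame counts as a singleton block,
  whose maximum is its absolute value.\<close>

definition block_norm :: "'n set set \<Rightarrow> real ^ 'n \<Rightarrow> real" where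
  "block_norm P x = (\<Sum>B\<in>P. MAX i\<in>B. \<bar>x $ i\<bar>)"

text \<open>If the maximum is attained at \<open>i\<close> in block \<open>B\<close>, every
  \<open>f j\<close> in another block is at most \<open>f i\<close> and has minimum 0 with it, so it
  is 0. Only \<open>B\<close> contributes to the sum.\<close>

lemma Max_eq_sum_Max_blocks:
  fixes f :: "'n::finite \<Rightarrow> real"
  assumes P: "partition_on UNIV P" and nonneg: "\<And>i. 0 \<le> f i"
    and min: "\<And>B C i j. B \<in> P \<Longrightarrow> C \<in> P \<Longrightarrow> B \<noteq> C \<Longrightarrow> i \<in> B \<Longrightarrow> j \<in> C \<Longrightarrow> min (f i) (f j) = 0"
  shows "(MAX i. f i) = (\<Sum>B\<in>P. MAX i\<in>B. f i)"
proof -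
  have "(MAX i. f i) \<in> range f" by (intro Max_in) auto
  then obtain i where i: "f i = (MAX i. f i)" by (metis imageE)
  have le: "f j \<le> f i" for j unfolding i by simp
  obtain B where B: "B \<in> P" "i \<in> B" using partition_onD1[OF P] by blast
  have "(MAX j\<in>C. f j) = 0" if C: "C \<in> P - {B}" for C
  proof -
    have "C \<noteq> {}" using C partition_onD3[OF P] by blast
    then have "(MAX j\<in>C. f j) \<in> f ` C" by (intro Max_in) auto
    then obtain j where j: "j \<in> C" "f j = (MAX j\<in>C. f j)" by (metis imageE)
    then show ?thesis using min[of B C i j] B C le[of j] by auto
  qed
  moreover have "finite P" using finite_elements[OF _ P] by simp
  ultimately have "(\<Sum>B\<in>P. MAX i\<in>B. f i) = (MAX i\<in>B. f i)"
    using B(1) by (simp add: sum.remove)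
  moreover have "(MAX i\<in>B. f i) = f i"
    using B(2) le by (intro Max_eqI) auto
  ultimately show ?thesis using i by simp
qed

text \<open>Almost surely the maximum splits over the blocks, and on each block \<open>Z\<close> is
  a single variable of mean 1 that factors out. Both directions of the theorem rest on this.\<close>

lemma generated_norm_eq_block_norm:
  fixes Z :: "'a \<Rightarrow> real ^ 'n"
  assumes g: "D_generator M Z" and P: "partition_on UNIV P"
    and eq: "\<And>B i j. B \<in> P \<Longrightarrow> i \<in> B \<Longrightarrow> j \<in> B \<Longrightarrow> AE w in M. Z w $ i = Z w $ j"
    and min: "\<And>B C i j. B \<in> P \<Longrightarrow> C \<in> P \<Longrightarrow> B \<noteq> C \<Longrightarrow> i \<in> B \<Longrightarrow> j \<in> C \<Longrightarrow>
      AE w in M. min (Z w $ i) (Z w $ j) = 0"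
  shows "generated_norm M Z = block_norm P"
proof
  fix x
  define r where "r B = (SOME i. i \<in> B)" for B :: "'n set"
  have ne: "B \<noteq> {}" if "B \<in> P" for B using that partition_onD3[OF P] by blast
  have r: "r B \<in> B" if "B \<in> P" for B
    using ne[OF that] by (simp add: r_def some_in_eq)
  have Z [measurable]: "Z \<in> borel_measurable M" using g by (simp add: D_generator_def)
  have [measurable]: "(\<lambda>w. Z w $ i) \<in> borel_measurable M" for i
    by (rule measurable_compose[OF Z measurable_vec_nth])
  have "AE w in M. \<forall>B\<in>P. \<forall>i\<in>B. Z w $ i = Z w $ r B"
    using eq r by (intro AE_finite_allI) auto
  moreover have "AE w in M. \<forall>B\<in>P. \<forall>C\<in>P - {B}. \<forall>i\<in>B. \<forall>j\<in>C. min (Z w $ i) (Z w $ j) = 0"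
    using min by (intro AE_finite_allI) auto
  ultimately have AE: "AE w in M. (MAX i. \<bar>x $ i\<bar> * Z w $ i) =
      (\<Sum>B\<in>P. (MAX i\<in>B. \<bar>x $ i\<bar>) * Z w $ r B)"
    using D_generator_AE_nonneg[OF g]
  proof eventually_elim
    case (elim w)
    have "(MAX i. \<bar>x $ i\<bar> * Z w $ i) = (\<Sum>B\<in>P. MAX i\<in>B. \<bar>x $ i\<bar> * Z w $ i)"
    proof (rule Max_eq_sum_Max_blocks[OF P])
      fix B C i j
      assume "B \<in> P" "C \<in> P" "B \<noteq> C" "i \<in> B" "j \<in> C"
      with elim(2) have "min (Z w $ i) (Z w $ j) = 0" by blast
      then have "Z w $ i = 0 \<or> Z w $ j = 0" by (auto simp: min_def split: if_splits)
      then show "min (\<bar>x $ i\<bar> * Z w $ i) (\<bar>x $ j\<bar> * Z w $ j) = 0"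
        using elim(3) by auto
    qed (use elim(3) in simp)
    also have "\<dots> = (\<Sum>B\<in>P. MAX i\<in>B. \<bar>x $ i\<bar> * Z w $ r B)"
      using elim(1) by (intro sum.cong arg_cong[of _ _ Max] image_cong) auto
    also have "\<dots> = (\<Sum>B\<in>P. (MAX i\<in>B. \<bar>x $ i\<bar>) * Z w $ r B)"
      using ne elim(3) by (intro sum.cong Max_mult_right) auto
    finally show ?case .
  qed
  have "generated_norm M Z x = (\<integral>w. (\<Sum>B\<in>P. (MAX i\<in>B. \<bar>x $ i\<bar>) * Z w $ r B) \<partial>M)"
    unfolding generated_norm_def using AE by (intro integral_cong_AE) measurable
  also have "\<dots> = block_norm P x"
    using g by (simp add: D_generator_def block_norm_def)
  finally show "generated_norm M Z x = block_norm P x" .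
qed

text \<open>The maximum exceeds either coordinate by a nonnegative variable of mean
  \<open>1 - 1 = 0\<close>, so it equals both almost surely.\<close>

lemma AE_eq_if_integral_max_eq_1:
  fixes Z :: "'a \<Rightarrow> real ^ 'n"
  assumes g: "D_generator M Z" and max: "(\<integral>w. max (Z w $ i) (Z w $ j) \<partial>M) = 1"
  shows "AE w in M. Z w $ i = Z w $ j"
proof -
  have *: "AE w in M. max (Z w $ i) (Z w $ j) - Z w $ l = 0" if "l \<in> {i, j}" for l
  proof (subst integral_nonneg_eq_0_iff_AE[symmetric])
    show "(\<integral>w. max (Z w $ i) (Z w $ j) - Z w $ l \<partial>M) = 0"
      using g max by (simp add: D_generator_def)
  qed (use g that in \<open>auto simp: D_generator_def\<close>)
  have "AE w in M. max (Z w $ i) (Z w $ j) - Z w $ i = 0"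
    "AE w in M. max (Z w $ i) (Z w $ j) - Z w $ j = 0"
    by (rule *, simp)+
  then show ?thesis by eventually_elim simp
qed

section \<open>Generators and idempotence of block norms\<close>

definition block_generator :: "'n set set \<Rightarrow> 'n set \<Rightarrow> real ^ 'n" where
  "block_generator P B = (\<chi> i. if i \<in> B then real (card P) else 0)"

lemma partition_UNIV_finite_nonempty:
  fixes P :: "'n::finite set set"
  assumes "partition_on UNIV P"
  shows "finite P" "P \<noteq> {}"
  using finite_elements[OF _ assms] partition_onD1[OF assms] by auto

lemma partition_sum_indicator:
  fixes P :: "'n::finite set set"
  assumes "partition_on UNIV P"
  shows "(\<Sum>B\<in>P. if i \<in> B then c else (0::real)) = c"
proof -
  obtain B where B: "B \<in> P" "i \<in> B" using partition_onD1[OF assms] by blast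
  have "(\<Sum>C\<in>P. if i \<in> C then c else (0::real)) = (\<Sum>C\<in>P. if C = B then c else 0)"
    using B partition_on_block_eq[OF assms] by (intro sum.cong) auto
  then show ?thesis using B(1) partition_UNIV_finite_nonempty[OF assms] by simp
qed

text \<open>The sample points are the blocks, drawn uniformly. An index lies in exactly one of them,
  so its coordinate is \<open>card P\<close> with probability \<open>1 / card P\<close>.\<close>

lemma D_generator_block_generator:
  fixes P :: "'n::finite set set"
  assumes P: "partition_on UNIV P"
  shows "D_generator (measure_pmf (pmf_of_set P)) (block_generator P)"
proof -
  note fin = partition_UNIV_finite_nonempty[OF P]
  show ?thesis
    using fin partition_sum_indicator[OF P]
    by (auto simp: D_generator_def block_generator_def integral_pmf_of_set
        measure_pmf.prob_space_axioms intro!: integrable_measure_pmf_finite)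
qed

lemma generated_norm_block_generator:
  fixes P :: "'n::finite set set"
  assumes P: "partition_on UNIV P"
  shows "generated_norm (measure_pmf (pmf_of_set P)) (block_generator P) = block_norm P"
proof (rule generated_norm_eq_block_norm[OF D_generator_block_generator[OF P] P])
  note fin = partition_UNIV_finite_nonempty[OF P]
  fix B i j assume "B \<in> P" "i \<in> B" "j \<in> B"
  then have "i \<in> C \<longleftrightarrow> j \<in> C" if "C \<in> P" for C
    using that partition_on_block_eq[OF P] by blast
  then show "AE w in pmf_of_set P. block_generator P w $ i = block_generator P w $ j"
    using fin by (auto simp: AE_measure_pmf_iff block_generator_def)
next
  note fin = partition_UNIV_finite_nonempty[OF P]
  fix B C i j assume "B \<in> P" "C \<in> P" "B \<noteq> C" "i \<in> B" "j \<in> C"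
  then have "\<not> (i \<in> D \<and> j \<in> D)" if "D \<in> P" for D
    using that partition_on_block_eq[OF P] by blast
  then show "AE w in pmf_of_set P. min (block_generator P w $ i) (block_generator P w $ j) = 0"
    using fin by (auto simp: AE_measure_pmf_iff block_generator_def)
qed

text \<open>The generator's value at \<open>B\<close> erases all other blocks and scales
  \<open>B\<close> by \<open>card P\<close>.\<close>

lemma block_norm_cmult_block_generator:
  fixes P :: "'n::finite set set"
  assumes P: "partition_on UNIV P" and B: "B \<in> P"
  shows "block_norm P (cmult x (block_generator P B)) = (MAX i\<in>B. \<bar>x $ i\<bar>) * card P"
proof -
  have ne: "C \<noteq> {}" if "C \<in> P" for C using that partition_onD3[OF P] by blast
  have "(MAX i\<in>C. \<bar>cmult x (block_generator P B) $ i\<bar>) =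
      (if C = B then (MAX i\<in>B. \<bar>x $ i\<bar>) * card P else 0)" if "C \<in> P" for C
  proof (cases "C = B")
    case True
    have "(MAX i\<in>B. \<bar>cmult x (block_generator P B) $ i\<bar>) = (MAX i\<in>B. \<bar>x $ i\<bar> * card P)"
      by (intro arg_cong[of _ _ Max] image_cong) (auto simp: cmult_def block_generator_def abs_mult)
    with True show ?thesis using ne[OF B] by (simp add: Max_mult_right)
  next
    case False
    then have "i \<notin> B" if "i \<in> C" for i
      using that partition_on_block_eq[OF P B \<open>C \<in> P\<close>] by blast
    then have "(MAX i\<in>C. \<bar>cmult x (block_generator P B) $ i\<bar>) = (MAX i\<in>C. 0)"
      by (intro arg_cong[of _ _ Max] image_cong) (simp_all add: cmult_def block_generator_def)
    with False show ?thesis using ne[OF that] by simp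
  qed
  then show ?thesis
    using B partition_UNIV_finite_nonempty[OF P] by (simp add: block_norm_def)
qed

text \<open>The product norm at \<open>x\<close> is the average over the drawn block
  \<open>B\<close> of the norm of \<open>x\<close> times the generator, that is, of
  \<open>card P\<close> times the maximum over \<open>B\<close>. The factor cancels against the
  uniform weight.\<close>

lemma idempotent_block_norm:
  fixes P :: "'n::finite set set"
  assumes P: "partition_on UNIV P"
  shows "idempotent_D_norm (block_norm P)"
  unfolding idempotent_D_norm_def
proof
  note fin = partition_UNIV_finite_nonempty[OF P]
  note g = D_generator_block_generator[OF P]
  note gn = generated_norm_block_generator[OF P]
  show "is_D_norm (block_norm P)"
    using is_D_norm_generated_norm[OF g] gn by simp
  have ne: "B \<noteq> {}" if "B \<in> P" for B using that partition_onD3[OF P] by blast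
  have nn: "0 \<le> (MAX i\<in>B. \<bar>x $ i\<bar>)" if "B \<in> P" for B and x :: "real ^ 'n"
    using ne[OF that] by (subst Max_ge_iff) auto
  show "D_norm_product (block_norm P) (block_norm P) = block_norm P"
  proof
    fix x
    have "AE B in pmf_of_set P. 0 \<le> block_norm P (cmult x (block_generator P B))"
      using fin by (auto simp: AE_measure_pmf_iff block_norm_cmult_block_generator[OF P] nn)
    then have "D_norm_product (block_norm P) (block_norm P) x =
        (\<integral>B. block_norm P (cmult x (block_generator P B)) \<partial>pmf_of_set P)"
      using D_norm_product_self[OF g, of x] by (simp add: gn integral_eq_nn_integral)
    also have "\<dots> = (\<Sum>B\<in>P. (MAX i\<in>B. \<bar>x $ i\<bar>) * card P) / card P"
      using fin by (simp add: integral_pmf_of_set block_norm_cmult_block_generator[OF P])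
    also have "\<dots> = block_norm P x"
      using fin by (simp add: block_norm_def sum_distrib_right[symmetric])
    finally show "D_norm_product (block_norm P) (block_norm P) x = block_norm P x" .
  qed
qed

lemma block_norm_restrict:
  fixes x :: "real ^ 'n"
  assumes P: "partition_on UNIV P" and C: "C \<in> P" and B: "B \<noteq> {}" "B \<subseteq> C"
  shows "block_norm P (\<Sum>i\<in>B. x $ i *\<^sub>R axis i 1) = (MAX i\<in>B. \<bar>x $ i\<bar>)"
proof -
  let ?f = "\<lambda>i. \<bar>if i \<in> B then x $ i else 0\<bar>"
  have "block_norm P (\<Sum>i\<in>B. x $ i *\<^sub>R axis i 1) = (\<Sum>C\<in>P. MAX i\<in>C. ?f i)"
    by (simp add: block_norm_def sum_scaleR_axis)
  \<comment> \<open>The splitting of a maximum over blocks is read backwards: \<open>?f\<close>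
    lives inside the single block \<open>C\<close>, so indices in distinct blocks are never both
    nonzero.\<close>
  also have "\<dots> = (MAX i. ?f i)"
  proof (rule Max_eq_sum_Max_blocks[OF P, symmetric])
    fix C1 C2 i j assume "C1 \<in> P" "C2 \<in> P" "C1 \<noteq> C2" "i \<in> C1" "j \<in> C2"
    then have "\<not> (i \<in> C \<and> j \<in> C)"
      using C partition_on_block_eq[OF P] by blast
    then show "min (?f i) (?f j) = 0" using B(2) by auto
  qed simp
  also have "\<dots> = (MAX i\<in>B. ?f i)"
    by (rule Max_restrict[OF B(1)]) auto
  also have "\<dots> = (MAX i\<in>B. \<bar>x $ i\<bar>)"
    by (intro arg_cong[of _ _ Max] image_cong) auto
  finally show ?thesis .
qed

text \<open>Each of the two blocks contributes at least 1. This separates the block norm from the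
  sup-norm on any index set meeting two blocks.\<close>

lemma block_norm_pair_distinct_blocks:
  fixes x :: "real ^ 'n"
  assumes P: "partition_on UNIV P" and CD: "C \<in> P" "D \<in> P" "C \<noteq> D"
    and ij: "i \<in> C" "j \<in> D" "x $ i = 1" "x $ j = 1"
  shows "2 \<le> block_norm P x"
proof -
  have ne: "B \<noteq> {}" if "B \<in> P" for B using that partition_onD3[OF P] by blast
  have "\<bar>x $ i\<bar> \<le> (MAX i\<in>C. \<bar>x $ i\<bar>)" "\<bar>x $ j\<bar> \<le> (MAX i\<in>D. \<bar>x $ i\<bar>)"
    using ij by (blast intro: Max_ge finite_imageI finite)+
  with ij have "2 \<le> (\<Sum>B\<in>{C, D}. MAX i\<in>B. \<bar>x $ i\<bar>)" using CD(3) by simp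
  also have "\<dots> \<le> block_norm P x"
    unfolding block_norm_def using CD ne partition_UNIV_finite_nonempty[OF P]
    by (intro sum_mono2) (auto simp: Max_ge_iff)
  finally show ?thesis .
qed

section \<open>Passing between complete dependence frames and partitions\<close>

definition frame_partition :: "nat \<Rightarrow> (nat \<Rightarrow> 'n set) \<Rightarrow> 'n set set" where
  "frame_partition K A = A ` {1..K} \<union> (\<lambda>i. {i}) ` (UNIV - (\<Union>k\<in>{1..K}. A k))"

lemma partition_on_frame_partition:
  assumes "\<forall>k\<in>{1..K}. A k \<noteq> {}" "disjoint_family_on A {1..K}"
  shows "partition_on UNIV (frame_partition K A)"
proof (rule partition_onI)
  have A_eq: "A k = A l" if "k \<in> {1..K}" "l \<in> {1..K}" "i \<in> A k" "i \<in> A l" for i k l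
    using disjoint_family_onD[OF assms(2) that(1,2)] that(3,4) by blast
  fix p q assume pq: "p \<in> frame_partition K A" "q \<in> frame_partition K A" "p \<noteq> q"
  have "p = q" if i: "i \<in> p" "i \<in> q" for i
  proof (cases "i \<in> (\<Union>k\<in>{1..K}. A k)")
    case True
    with i pq obtain k l where "k \<in> {1..K}" "p = A k" "l \<in> {1..K}" "q = A l"
      unfolding frame_partition_def by blast
    then show ?thesis using A_eq i by blast
  next
    case False
    then have "p = {i}" "q = {i}" using i pq(1,2) unfolding frame_partition_def by blast+
    then show ?thesis by simp
  qed
  with pq(3) show "disjnt p q" by (auto simp: disjnt_iff)
qed (use assms(1) in \<open>auto simp: frame_partition_def\<close>)

lemma block_norm_frame_partition:
  fixes x :: "real ^ 'n"
  assumes "\<forall>k\<in>{1..K}. A k \<noteq> {}" "disjoint_family_on A {1..K}"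
  shows "block_norm (frame_partition K A) x =
    (\<Sum>k=1..K. MAX i\<in>A k. \<bar>x $ i\<bar>) + (\<Sum>i\<in>UNIV - (\<Union>k\<in>{1..K}. A k). \<bar>x $ i\<bar>)"
proof -
  \<comment> \<open>Nonempty disjoint sets are distinct, so the sum over the image of
    \<open>A\<close> is the sum over \<open>k\<close>, with no term merged.\<close>
  have "inj_on A {1..K}"
    using assms by (fastforce simp: inj_on_def disjoint_family_on_def)
  moreover have "A ` {1..K} \<inter> (\<lambda>i. {i}) ` (UNIV - (\<Union>k\<in>{1..K}. A k)) = {}"
    by blast
  ultimately show ?thesis
    unfolding block_norm_def frame_partition_def
    by (subst sum.union_disjoint) (auto simp: sum.reindex)
qed

text \<open>The frame selects the case of the dichotomy. Within a block the sup-norm makes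
  coordinates equal almost surely; across blocks equality would force the sup-norm on the pair,
  which the frame excludes, so the minimum vanishes.\<close>

lemma idempotent_frame_block_norm:
  fixes N :: "real ^ 'n \<Rightarrow> real"
  assumes idem: "idempotent_D_norm N" and cdf: "complete_dependence_frame N K A" and "K \<noteq> 0"
  shows "N = block_norm (frame_partition K A)"
proof -
  let ?P = "frame_partition K A"
  obtain M :: "(real ^ 'n) measure" and Z where g: "D_generator M Z" and N: "N = generated_norm M Z"
    using idem by (auto simp: idempotent_D_norm_def is_D_norm_def)
  have ne: "\<forall>k\<in>{1..K}. A k \<noteq> {}" and disj: "disjoint_family_on A {1..K}"
    and block: "\<And>k x. k \<in> {1..K} \<Longrightarrow> N (\<Sum>i\<in>A k. x $ i *\<^sub>R axis i 1) = (MAX i\<in>A k. \<bar>x $ i\<bar>)"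
    and other: "\<And>B. 2 \<le> card B \<Longrightarrow> \<forall>k\<in>{1..K}. \<not> B \<subseteq> A k \<Longrightarrow>
      \<exists>x. N (\<Sum>i\<in>B. x $ i *\<^sub>R axis i 1) \<noteq> (MAX i\<in>B. \<bar>x $ i\<bar>)"
    using cdf \<open>K \<noteq> 0\<close> unfolding complete_dependence_frame_def by (auto split: if_splits)
  have P: "partition_on UNIV ?P" by (rule partition_on_frame_partition[OF ne disj])
  show ?thesis
    unfolding N
  proof (rule generated_norm_eq_block_norm[OF g P])
    fix B i j assume B: "B \<in> ?P" "i \<in> B" "j \<in> B"
    show "AE w in M. Z w $ i = Z w $ j"
    proof (cases "i = j")
      case False
      with B obtain k where k: "k \<in> {1..K}" "i \<in> A k" "j \<in> A k"
        by (auto simp: frame_partition_def)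
      \<comment> \<open>The indicator of the pair has the same restriction to \<open>{i, j}\<close>
        and to \<open>A k\<close>, so the sup-norm on \<open>A k\<close> gives the pair norm
        1.\<close>
      define x :: "real ^ 'n" where "x = (\<chi> l. if l \<in> {i, j} then 1 else 0)"
      have "(\<Sum>l\<in>{i, j}. x $ l *\<^sub>R axis l (1::real)) = (\<Sum>l\<in>A k. x $ l *\<^sub>R axis l 1)"
        unfolding sum_scaleR_axis using k by (auto simp: x_def vec_eq_iff)
      moreover have "(MAX l\<in>A k. \<bar>x $ l\<bar>) = 1"
        using k by (intro Max_eqI) (auto simp: x_def intro!: image_eqI[of _ _ i])
      ultimately have "(\<integral>w. max (\<bar>x $ i\<bar> * Z w $ i) (\<bar>x $ j\<bar> * Z w $ j) \<partial>M) = 1"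
        using block[OF k(1), of x] generated_norm_pair[OF g, of x i j] by (simp add: N)
      then show ?thesis
        by (intro AE_eq_if_integral_max_eq_1[OF g]) (simp add: x_def)
    qed simp
  next
    fix B C i j assume BC: "B \<in> ?P" "C \<in> ?P" "B \<noteq> C" "i \<in> B" "j \<in> C"
    have "i \<noteq> j" using BC partition_on_block_eq[OF P] by blast
    have "\<forall>k\<in>{1..K}. \<not> {i, j} \<subseteq> A k"
    proof (intro ballI notI)
      fix k assume "k \<in> {1..K}" "{i, j} \<subseteq> A k"
      then have "A k \<in> ?P" "i \<in> A k" "j \<in> A k" by (auto simp: frame_partition_def)
      then show False using BC partition_on_block_eq[OF P] by blast
    qed
    then obtain x where x: "N (\<Sum>l\<in>{i, j}. x $ l *\<^sub>R axis l 1) \<noteq> (MAX l\<in>{i, j}. \<bar>x $ l\<bar>)"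
      using other[of "{i, j}"] \<open>i \<noteq> j\<close> by auto
    have "\<not> (AE w in M. Z w $ i = Z w $ j)"
    proof
      assume AE: "AE w in M. Z w $ i = Z w $ j"
      \<comment> \<open>With equal coordinates the common factor of mean 1 comes out, and the norm
        at \<open>x\<close> becomes the sup-norm that \<open>x\<close> was chosen to
        violate.\<close>
      have "(\<integral>w. max (\<bar>x $ i\<bar> * Z w $ i) (\<bar>x $ j\<bar> * Z w $ j) \<partial>M) =
          (\<integral>w. max \<bar>x $ i\<bar> \<bar>x $ j\<bar> * Z w $ i \<partial>M)"
      proof (rule integral_cong_AE)
        have Z: "Z \<in> borel_measurable M" using g by (simp add: D_generator_def)
        have [measurable]: "(\<lambda>w. Z w $ i) \<in> borel_measurable M" for i
          by (rule measurable_compose[OF Z measurable_vec_nth])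
        show "(\<lambda>w. max (\<bar>x $ i\<bar> * Z w $ i) (\<bar>x $ j\<bar> * Z w $ j)) \<in> borel_measurable M"
          "(\<lambda>w. max \<bar>x $ i\<bar> \<bar>x $ j\<bar> * Z w $ i) \<in> borel_measurable M" by measurable
        show "AE w in M. max (\<bar>x $ i\<bar> * Z w $ i) (\<bar>x $ j\<bar> * Z w $ j) =
            max \<bar>x $ i\<bar> \<bar>x $ j\<bar> * Z w $ i"
          using AE D_generator_AE_nonneg[OF g]
          by eventually_elim (simp add: max_mult_distrib_right)
      qed
      also have "\<dots> = (MAX l\<in>{i, j}. \<bar>x $ l\<bar>)"
        using g by (simp add: D_generator_def)
      finally show False
        using x generated_norm_pair[OF g, of x i j] by (simp add: N)
    qed
    then show "AE w in M. min (Z w $ i) (Z w $ j) = 0"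
      using idempotent_pair[OF g _ \<open>i \<noteq> j\<close>] idem N by blast
  qed
qed

lemma complete_dependence_frame_block_norm:
  fixes A :: "nat \<Rightarrow> 'n::finite set"
  assumes K: "1 \<le> K" "K < CARD('n)"
    and A: "\<forall>k\<in>{1..K}. A k \<noteq> {} \<and> 2 \<le> card (A k)" and disj: "disjoint_family_on A {1..K}"
  shows "complete_dependence_frame (block_norm (frame_partition K A)) K A"
proof -
  let ?P = "frame_partition K A"
  let ?N = "block_norm ?P"
  have P: "partition_on UNIV ?P" using A disj by (intro partition_on_frame_partition) auto
  have A_in: "A k \<in> ?P" if "k \<in> {1..K}" for k using that by (simp add: frame_partition_def)
  \<comment> \<open>Two distinct indices of \<open>A 1\<close> yield a bivariate projection equal to
    the sup-norm, which selects the nonempty branch of the frame definition.\<close>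
  have one: "1 \<in> {1..K}" using K(1) by simp
  then have "2 \<le> card (A 1)" using A by blast
  then have "\<not> card (A 1) \<le> Suc 0" by linarith
  then obtain i j where ij: "i \<in> A 1" "j \<in> A 1" "i \<noteq> j"
    using card_le_Suc0_iff_eq[OF finite[of "A 1"]] by blast
  have "bivariate_projection ?N i j = infnorm"
  proof
    fix v :: "real ^ 2"
    define x :: "real ^ 'n" where "x = (\<chi> l. if l = i then v $ 1 else v $ 2)"
    have "bivariate_projection ?N i j v = ?N (\<Sum>l\<in>{i, j}. x $ l *\<^sub>R axis l 1)"
      using ij(3) by (simp add: bivariate_projection_def x_def)
    also have "\<dots> = (MAX l\<in>{i, j}. \<bar>x $ l\<bar>)"
      by (rule block_norm_restrict[OF P A_in[OF one]]) (use ij in blast)+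
    also have "\<dots> = infnorm v"
      using ij(3) by (simp add: infnorm_2 x_def)
    finally show "bivariate_projection ?N i j v = infnorm v" .
  qed
  then have ex: "\<exists>i j. i \<noteq> j \<and> bivariate_projection ?N i j = infnorm"
    using ij(3) by blast
  have block: "?N (\<Sum>i\<in>A k. x $ i *\<^sub>R axis i 1) = (MAX i\<in>A k. \<bar>x $ i\<bar>)" if "k \<in> {1..K}" for k x
    by (rule block_norm_restrict[OF P A_in[OF that]]) (use A that in blast)+
  have other: "\<not> (\<forall>x. ?N (\<Sum>i\<in>B. x $ i *\<^sub>R axis i 1) = (MAX i\<in>B. \<bar>x $ i\<bar>))"
    if B: "2 \<le> card B" "\<forall>k\<in>{1..K}. \<not> B \<subseteq> A k" for B
  proof -
    have "B \<noteq> {}" using B(1) by auto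
    then obtain i where i: "i \<in> B" by blast
    obtain C where C: "C \<in> ?P" "i \<in> C" using partition_onD1[OF P] by blast
    have "\<not> B \<subseteq> C"
    proof
      assume "B \<subseteq> C"
      \<comment> \<open>A block with two elements is not one of the added singletons, so it is some
        \<open>A k\<close>, which \<open>B\<close> is assumed not to lie in.\<close>
      then have "2 \<le> card C" using B(1) card_mono[of C B] by simp
      with C(1) \<open>B \<subseteq> C\<close> B(2) show False by (auto simp: frame_partition_def)
    qed
    then obtain j where j: "j \<in> B" "j \<notin> C" by blast
    obtain D where D: "D \<in> ?P" "j \<in> D" using partition_onD1[OF P] by blast
    \<comment> \<open>The all-ones vector restricted to \<open>B\<close> has maximum 1, but block
      norm at least 2 because \<open>B\<close> meets both \<open>C\<close> and
      \<open>D\<close>.\<close>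
    define x :: "real ^ 'n" where "x = (\<chi> i. 1)"
    have "2 \<le> ?N (\<Sum>i\<in>B. x $ i *\<^sub>R axis i 1)"
      unfolding sum_scaleR_axis using C D i j
      by (intro block_norm_pair_distinct_blocks[OF P C(1) D(1) _ C(2) D(2)]) (auto simp: x_def)
    moreover have "(MAX i\<in>B. \<bar>x $ i\<bar>) = 1"
      using \<open>B \<noteq> {}\<close> by (simp add: x_def)
    ultimately have "?N (\<Sum>i\<in>B. x $ i *\<^sub>R axis i 1) \<noteq> (MAX i\<in>B. \<bar>x $ i\<bar>)" by linarith
    then show ?thesis by blast
  qed
  show ?thesis
    unfolding complete_dependence_frame_def if_P[OF ex]
    by (intro conjI allI impI K A disj ballI block) (use other in blast)+
qed

theorem theorem3p5:
  shows "(\<forall>(N :: real ^ 'n \<Rightarrow> real) K A.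
            idempotent_D_norm N \<and> complete_dependence_frame N K A \<and> K \<noteq> 0 \<longrightarrow>
            (\<forall>x. N x = (\<Sum>k=1..K. MAX i\<in>A k. \<bar>x $ i\<bar>) +
                       (\<Sum>i\<in>UNIV - (\<Union>k\<in>{1..K}. A k). \<bar>x $ i\<bar>))) \<and>
         (\<forall>K (A :: nat \<Rightarrow> 'n set).
            1 \<le> K \<and> K < CARD('n) \<and> (\<forall>k\<in>{1..K}. A k \<noteq> {} \<and> 2 \<le> card (A k)) \<and>
            disjoint_family_on A {1..K} \<longrightarrow>
            (let N = (\<lambda>x :: real ^ 'n. (\<Sum>k=1..K. MAX i\<in>A k. \<bar>x $ i\<bar>) +
                       (\<Sum>i\<in>UNIV - (\<Union>k\<in>{1..K}. A k). \<bar>x $ i\<bar>))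
             in idempotent_D_norm N \<and> complete_dependence_frame N K A))"
proof (intro conjI allI impI)
  fix N :: "real ^ 'n \<Rightarrow> real" and K A x
  assume N: "idempotent_D_norm N \<and> complete_dependence_frame N K A \<and> K \<noteq> 0"
  then have "\<forall>k\<in>{1..K}. A k \<noteq> {}" "disjoint_family_on A {1..K}"
    by (auto simp: complete_dependence_frame_def split: if_splits)
  from block_norm_frame_partition[OF this]
  show "N x = (\<Sum>k=1..K. MAX i\<in>A k. \<bar>x $ i\<bar>) + (\<Sum>i\<in>UNIV - (\<Union>k\<in>{1..K}. A k). \<bar>x $ i\<bar>)"
    using idempotent_frame_block_norm[of N K A] N by simp
next
  fix K and A :: "nat \<Rightarrow> 'n set"
  assume A: "1 \<le> K \<and> K < CARD('n) \<and> (\<forall>k\<in>{1..K}. A k \<noteq> {} \<and> 2 \<le> card (A k)) \<and>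
    disjoint_family_on A {1..K}"
  then have frame: "\<forall>k\<in>{1..K}. A k \<noteq> {}" "disjoint_family_on A {1..K}" by auto
  show "let N = (\<lambda>x :: real ^ 'n. (\<Sum>k=1..K. MAX i\<in>A k. \<bar>x $ i\<bar>) +
      (\<Sum>i\<in>UNIV - (\<Union>k\<in>{1..K}. A k). \<bar>x $ i\<bar>))
    in idempotent_D_norm N \<and> complete_dependence_frame N K A"
    unfolding Let_def block_norm_frame_partition[OF frame, symmetric]
    using idempotent_block_norm[OF partition_on_frame_partition[OF frame]]
      complete_dependence_frame_block_norm[of K A] A by simp
qed

end
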